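(* Let $n_1,\dots,n_k\ge 1$ be integers, $N=n_1+\cdots+n_k$, and let $\lambda_i, a_{in}\in\mathbb{C}$ ($1\le i\le k$, $0\le n\le n_i-1$). Put $f_{[A_i]}(x)=\sum_{n=0}^{n_i-1}a_{in}x^n$, $A_i=f_{[A_i]}(J_{n_i}(0))$, $J=\bigoplus_{i=1}^k J_{n_i}(\lambda_i)$, $A=\bigoplus_{i=1}^k A_i$, and let $E$ be the $N\times N$ identity matrix. Let $z_2\in\mathbb{C}$ satisfy $1+z_2a_{i0}\neq 0$ for all $i$, and $1+z_2(a_{i0}-a_{i1}\lambda_i)\neq0$ for all $i$ with $n_i\ge2$. For each $i$ define the power series at $x=0$ $$f_{i}(x)=\frac{\lambda_i+x}{1+z_2f_{[A_i]}(x)},\qquad g_{i}(x)=\frac{f_{[A_i]}(x)}{1+z_2f_{[A_i]}(x)},$$ and let $f_i^{-1}$ denote the compositional inverse of $f_i$ (modulo $x^{n_i}$). Then there exist invertible $N\times N$ complex matrices $P,Q$ such that $$P(E+z_2A)Q=E,\qquad PJQ=\bigoplus_{i=1}^k J_{n_i}\!\left(\frac{\lambda_i}{1+z_2a_{i0}}\right),\qquad PAQ=\bigoplus_{i=1}^k A_i'',$$ where $$A_i''=\bigl(g_i\circ f_i^{-1}\bigr)\!\left(J_{n_i}\!\left(\frac{\lambda_i}{1+z_2a_{i0}}\right)\right).$$ In particular the triples $(E,J,A)$ and $\bigl(E,\bigoplus_i J_{n_i}(\tfrac{\lambda_i}{1+z_2a_{i0}}),\bigoplus_i A_i''\bigr)$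 are SLOCC equivalent.
   Context: $J_n(\lambda)$ is the $n\times n$ upper triangular Jordan block with eigenvalue $\lambda$ (ones on the superdiagonal), so $J_n(\lambda)=\lambda+J_n(0)$ and $J_n(0)^n=0$. A power series in $x$ is evaluated at $J_n(0)$ by truncating modulo $x^n$. Compositional inverse: if $f(x)=\mu+c_1x+c_2x^2+\cdots$ is a power series with $c_1\neq0$ (this condition is vacuous when $n=1$), then $f^{-1}(t)$ is a polynomial in $(t-\mu)$ without constant term, determined modulo $(t-\mu)^n$ by $f^{-1}(f(x))\equiv x \pmod{x^n}$ (when $n=1$ it is $0$). The matrix $(g\circ f^{-1})(J_n(\mu))$ is $g(f^{-1}(J_n(\mu)))$, obtained by substituting $t-\mu=J_n(0)$; it is well defined because $J_n(0)^n=0$. A pure state of a $3\times N\times N$ system is represented by a triple $(\Gamma_1,\Gamma_2,\Gamma_3)$ of complex $N\times N$ matrices. Two triples $(\Gamma_1,\Gamma_2,\Gamma_3)$ and $(\Gamma_1',\Gamma_2',\Gamma_3')$ are SLOCC equivalent if there are an invertible complex $3\times3$ matrix $T=(T_{ij})$ and invertible complex $N\times N$ matrices $P,Q$ with $\sum_{j=1}^3T_{ij}P\Gamma_jQ=\Gamma_i'$ for $i=1,2,3$. *)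

theory Defs
  imports
    Complex_Main
    "HOL-Computational_Algebra.Formal_Power_Series"
    "Jordan_Normal_Form.Jordan_Normal_Form"
begin

text \<open>Value of a power series at an \<open>n \<times> n\<close> matrix \<open>X\<close> with \<open>X ^ n = 0\<close>, by truncation at
  degree \<open>n\<close>.\<close>

definition fps_at_mat :: "nat \<Rightarrow> complex fps \<Rightarrow> complex mat \<Rightarrow> complex mat" where
  "fps_at_mat n f X = mat n n (\<lambda>rc. \<Sum>m<n. fps_nth f m * (X ^\<^sub>m m) $$ rc)"

text \<open>Compositional inverse modulo degree \<open>n\<close>. If \<open>f = \<mu> + c\<^sub>1 x + \<dots>\<close>, then
  \<open>comp_inv n f\<close> is the expansion of the inverse in powers of \<open>t - \<mu>\<close>, cut off at degree \<open>n\<close>.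
  Evaluating the inverse at \<open>M\<close> therefore means substituting \<open>M - \<mu>\<close>. The lemmas
  \<open>comp_inv_compose\<close> and \<open>comp_inv_unique\<close> show that it is the polynomial determined by
  \<open>f\<^sup>-\<^sup>1 (f x) = x\<close> modulo \<open>x ^ n\<close>; \<open>c\<^sub>1 \<noteq> 0\<close> is only needed for \<open>n \<ge> 2\<close>, and the inverse is
  \<open>0\<close> for \<open>n = 1\<close>.\<close>

definition comp_inv :: "nat \<Rightarrow> complex fps \<Rightarrow> complex fps" where
  "comp_inv n f = fps_cutoff n (fps_inv (f - fps_const (fps_nth f 0)))"

definition comp_inv_at_mat :: "nat \<Rightarrow> complex fps \<Rightarrow> complex mat \<Rightarrow> complex mat" where
  "comp_inv_at_mat n f M = fps_at_mat n (comp_inv n f) (M - fps_nth f 0 \<cdot>\<^sub>m 1\<^sub>m n)"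

lemma comp_inv_nth_0: "fps_nth (comp_inv n f) 0 = 0"
  by (simp add: comp_inv_def fps_inv_def)

lemma comp_inv_1: "comp_inv (Suc 0) f = 0"
  by (simp add: comp_inv_def fps_eq_iff fps_inv_def)

lemma comp_inv_compose:
  assumes "n \<ge> 2 \<Longrightarrow> fps_nth f 1 \<noteq> 0" and "m < n"
  shows "fps_nth (comp_inv n f oo (f - fps_const (fps_nth f 0))) m = fps_nth fps_X m"
proof (cases "n \<ge> 2")
  case True
  let ?F = "f - fps_const (fps_nth f 0)"
  have "fps_nth (comp_inv n f oo ?F) m = fps_nth (fps_inv ?F oo ?F) m"
    using assms(2) by (auto simp: fps_compose_nth comp_inv_def intro!: sum.cong)
  also have "fps_inv ?F oo ?F = fps_X"
    using assms(1)[OF True] by (intro fps_inv) auto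
  finally show ?thesis .
next
  case False
  with assms(2) have "m = 0" by simp
  then show ?thesis by (simp add: comp_inv_nth_0)
qed

lemma comp_inv_unique:
  assumes "n \<ge> 2 \<Longrightarrow> fps_nth f 1 \<noteq> 0"
    and "fps_nth h 0 = 0"
    and h: "\<And>m. m < n \<Longrightarrow>
      fps_nth (h oo (f - fps_const (fps_nth f 0))) m = fps_nth fps_X m"
    and "m < n"
  shows "fps_nth h m = fps_nth (comp_inv n f) m"
  using \<open>m < n\<close>
proof (induction m rule: less_induct)
  case (less m)
  let ?F = "f - fps_const (fps_nth f 0)"
  let ?g = "comp_inv n f"
  show ?case
  proof (cases m)
    case 0
    then show ?thesis using assms(2) by (simp add: comp_inv_nth_0)
  next
    case (Suc l)
    with less.prems have "n \<ge> 2" by simp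
    then have f1: "fps_nth f 1 \<noteq> 0" by (rule assms(1))
    have top: "fps_nth (?F ^ m) m = fps_nth f 1 ^ m"
      using startsby_zero_power_nth_same[of ?F m] by simp
    have split: "fps_nth (k oo ?F) m =
        (\<Sum>i<m. fps_nth k i * fps_nth (?F ^ i) m) + fps_nth k m * fps_nth (?F ^ m) m" for k
      by (simp add: fps_compose_nth atLeast0AtMost flip: lessThan_Suc_atMost)
    have "(\<Sum>i<m. fps_nth h i * fps_nth (?F ^ i) m) =
        (\<Sum>i<m. fps_nth ?g i * fps_nth (?F ^ i) m)"
      using less.IH less.prems by (intro sum.cong) auto
    moreover have "fps_nth (h oo ?F) m = fps_nth (?g oo ?F) m"
      using h[OF less.prems] comp_inv_compose[OF assms(1) less.prems] by simp
    ultimately have "fps_nth h m * fps_nth (?F ^ m) m = fps_nth ?g m * fps_nth (?F ^ m) m"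
      using split[of h] split[of ?g] by simp
    then show ?thesis using f1 by (simp add: top)
  qed
qed

text \<open>A state of a \<open>3 \<times> N \<times> N\<close> system is a list of three \<open>N \<times> N\<close> matrices.\<close>

definition slocc_equiv :: "nat \<Rightarrow> complex mat list \<Rightarrow> complex mat list \<Rightarrow> bool" where
  "slocc_equiv N \<Gamma> \<Gamma>' \<longleftrightarrow>
     length \<Gamma> = 3 \<and> set \<Gamma> \<subseteq> carrier_mat N N \<and>
     length \<Gamma>' = 3 \<and> set \<Gamma>' \<subseteq> carrier_mat N N \<and>
     (\<exists>T P Q. T \<in> carrier_mat 3 3 \<and> invertible_mat T \<and>
        P \<in> carrier_mat N N \<and> invertible_mat P \<and>
        Q \<in> carrier_mat N N \<and> invertible_mat Q \<and>
        (\<forall>i<3. T $$ (i, 0) \<cdot>\<^sub>m (P * (\<Gamma> ! 0) * Q) + T $$ (i, 1) \<cdot>\<^sub>m (P * (\<Gamma> ! 1) * Q)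
                + T $$ (i, 2) \<cdot>\<^sub>m (P * (\<Gamma> ! 2) * Q) = \<Gamma>' ! i))"

end

(* Row vectors of length n are power series modulo x^n, and f(J_n(0)) is then multiplication by f.
   On one block put D = 1 + z A and F = D^(-1) (lam + x) - mu, so F(0) = 0 and F'(0) is nonzero
   when n >= 2.  The matrix P with rows F^i is therefore invertible, and it satisfies
   u(J_n(0)) P = P (u o F)(J_n(0)).  With Q = D^(-1)(J_n(0)) P^(-1), multiplication by D, lam + x
   and A becomes multiplication by the series whose composites with F are
   1, mu + F and A / D. *)

theory Submission
  imports Defs
begin

section \<open>Matrices of truncated power series\<close>

text \<open>One encoding serves two kinds of matrices: rows \<open>fps_X ^ i * f\<close> describe
  multiplication by \<open>f\<close>, rows \<open>F ^ i\<close> describe substitution of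
  \<open>F\<close>. Each kind acts from the right by a simple rule on the series in the
  rows.\<close>

definition fps_rows :: "nat \<Rightarrow> (nat \<Rightarrow> complex fps) \<Rightarrow> complex mat" where
  "fps_rows n R = mat n n (\<lambda>(i, j). fps_nth (R i) j)"

text \<open>Multiplication by \<open>f\<close> modulo x^n in the basis 1, x, x^2, ...; this is the
  upper triangular Toeplitz matrix f(J_n(0)).\<close>

definition toeplitz :: "nat \<Rightarrow> complex fps \<Rightarrow> complex mat" where
  "toeplitz n f = fps_rows n (\<lambda>i. fps_X ^ i * f)"

lemma fps_rows_carrier [simp]: "fps_rows n R \<in> carrier_mat n n"
  by (simp add: fps_rows_def)

lemma toeplitz_carrier [simp]: "toeplitz n f \<in> carrier_mat n n"
  by (simp add: toeplitz_def)

lemma dim_fps_rows [simp]: "dim_row (fps_rows n R) = n" "dim_col (fps_rows n R) = n"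
  by (simp_all add: fps_rows_def)

lemma dim_toeplitz [simp]: "dim_row (toeplitz n f) = n" "dim_col (toeplitz n f) = n"
  by (simp_all add: toeplitz_def)

lemma fps_rows_index: "i < n \<Longrightarrow> j < n \<Longrightarrow> fps_rows n R $$ (i, j) = fps_nth (R i) j"
  by (simp add: fps_rows_def)

lemma toeplitz_index:
  "i < n \<Longrightarrow> j < n \<Longrightarrow> toeplitz n f $$ (i, j) = (if j < i then 0 else fps_nth f (j - i))"
  by (simp add: toeplitz_def fps_rows_index fps_X_power_mult_nth)

text \<open>Turns congruences modulo x^n into matrix equalities, which is the precision to which
  \<open>comp_inv\<close> inverts.\<close>

lemma toeplitz_cong:
  assumes "\<And>m. m < n \<Longrightarrow> fps_nth f m = fps_nth g m"
  shows "toeplitz n f = toeplitz n g"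
proof (rule eq_matI)
  fix i j assume "i < dim_row (toeplitz n g)" "j < dim_col (toeplitz n g)"
  then have "i < n" "j < n" by auto
  then show "toeplitz n f $$ (i, j) = toeplitz n g $$ (i, j)"
    using assms by (simp add: toeplitz_index)
qed auto

text \<open>The entries with \<open>k > j\<close> of the Toeplitz factor vanish, so the matrix
  product is the Cauchy product in each row.\<close>

lemma fps_rows_mult_toeplitz: "fps_rows n R * toeplitz n f = fps_rows n (\<lambda>i. R i * f)"
proof (rule eq_matI)
  fix i j assume "i < dim_row (fps_rows n (\<lambda>i. R i * f))" "j < dim_col (fps_rows n (\<lambda>i. R i * f))"
  then have ij: "i < n" "j < n" by (auto simp: fps_rows_def)
  have "(fps_rows n R * toeplitz n f) $$ (i, j) =
      (\<Sum>k = 0..<n. fps_nth (R i) k * (if j < k then 0 else fps_nth f (j - k)))"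
    using ij by (auto simp: scalar_prod_def fps_rows_index toeplitz_index intro!: sum.cong)
  also have "\<dots> = (\<Sum>k = 0..j. fps_nth (R i) k * fps_nth f (j - k))"
    using ij by (intro sum.mono_neutral_cong_right) auto
  finally show "(fps_rows n R * toeplitz n f) $$ (i, j) = fps_rows n (\<lambda>i. R i * f) $$ (i, j)"
    using ij by (simp add: fps_rows_index fps_mult_nth)
qed (auto simp: fps_rows_def toeplitz_def)

text \<open>Since F(0) = 0, the series F^k has no coefficient in degree j < k. The sum over
  \<open>k < n\<close> therefore stops at \<open>k = j\<close>, where it is the j-th coefficient of
  the composite.\<close>

lemma fps_rows_mult_powers:
  assumes "fps_nth F 0 = 0"
  shows "fps_rows n R * fps_rows n (\<lambda>i. F ^ i) = fps_rows n (\<lambda>i. R i oo F)"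
proof (rule eq_matI)
  fix i j assume "i < dim_row (fps_rows n (\<lambda>i. R i oo F))" "j < dim_col (fps_rows n (\<lambda>i. R i oo F))"
  then have ij: "i < n" "j < n" by (auto simp: fps_rows_def)
  have "(fps_rows n R * fps_rows n (\<lambda>i. F ^ i)) $$ (i, j) =
      (\<Sum>k = 0..<n. fps_nth (R i) k * fps_nth (F ^ k) j)"
    using ij by (auto simp: scalar_prod_def fps_rows_def intro!: sum.cong)
  also have "\<dots> = (\<Sum>k = 0..j. fps_nth (R i) k * fps_nth (F ^ k) j)"
    using ij startsby_zero_power_prefix[OF assms] by (intro sum.mono_neutral_right) auto
  finally show "(fps_rows n R * fps_rows n (\<lambda>i. F ^ i)) $$ (i, j) = fps_rows n (\<lambda>i. R i oo F) $$ (i, j)"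
    using ij by (simp add: fps_rows_index fps_compose_nth)
qed (auto simp: fps_rows_def)

lemma toeplitz_mult: "toeplitz n f * toeplitz n g = toeplitz n (f * g)"
  \<comment> \<open>The right factor stays folded, because \<open>fps_rows_mult_toeplitz\<close>
    expects a \<open>toeplitz\<close> there.\<close>
  by (simp add: toeplitz_def[of n f] toeplitz_def[of n "f * g"] fps_rows_mult_toeplitz mult.assoc)

lemma toeplitz_one: "toeplitz n 1 = 1\<^sub>m n"
  by (rule eq_matI) (auto simp: toeplitz_def fps_rows_def)

lemma toeplitz_add: "toeplitz n (f + g) = toeplitz n f + toeplitz n g"
  by (rule eq_matI) (auto simp: toeplitz_def fps_rows_def algebra_simps)

lemma toeplitz_const_mult: "toeplitz n (fps_const c * f) = c \<cdot>\<^sub>m toeplitz n f"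
  by (rule eq_matI) (auto simp: toeplitz_def fps_rows_def fps_X_power_mult_nth)

section \<open>Jordan blocks and power series evaluated at matrices\<close>

lemma jordan_block_eq_toeplitz: "jordan_block n c = toeplitz n (fps_const c + fps_X)"
proof (rule eq_matI)
  fix i j assume "i < dim_row (toeplitz n (fps_const c + fps_X))"
    "j < dim_col (toeplitz n (fps_const c + fps_X))"
  then have "i < n" "j < n" by (auto simp: toeplitz_def fps_rows_def)
  then show "jordan_block n c $$ (i, j) = toeplitz n (fps_const c + fps_X) $$ (i, j)"
    by (auto simp: toeplitz_index fps_X_def)
qed (auto simp: toeplitz_def fps_rows_def)

lemma toeplitz_power: "toeplitz n u ^\<^sub>m m = toeplitz n (u ^ m)"
proof (induction m)
  case 0
  then show ?case by (simp add: toeplitz_one)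
next
  case (Suc m)
  then show ?case by (simp add: toeplitz_mult mult.commute)
qed

text \<open>With u(0) = 0 the powers u^m with m > j - i do not reach degree j - i, so truncation at
  \<open>n\<close> loses nothing. The case \<open>u = fps_X\<close> is evaluation at J_n(0); the
  case \<open>u = comp_inv n f\<close> is evaluation at f^(-1)(J_n(\<mu>)).\<close>

lemma fps_at_mat_toeplitz:
  assumes "fps_nth u 0 = 0"
  shows "fps_at_mat n g (toeplitz n u) = toeplitz n (g oo u)"
proof (rule eq_matI)
  fix i j assume "i < dim_row (toeplitz n (g oo u))" "j < dim_col (toeplitz n (g oo u))"
  then have ij: "i < n" "j < n" by (auto simp: toeplitz_def fps_rows_def)
  have "(\<Sum>m<n. fps_nth g m * fps_nth (u ^ m) (j - i)) =
      (\<Sum>m = 0..j - i. fps_nth g m * fps_nth (u ^ m) (j - i))"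
    using ij startsby_zero_power_prefix[OF assms] by (intro sum.mono_neutral_right) auto
  then show "fps_at_mat n g (toeplitz n u) $$ (i, j) = toeplitz n (g oo u) $$ (i, j)"
    using ij by (simp add: fps_at_mat_def toeplitz_power toeplitz_index fps_compose_nth)
qed (auto simp: fps_at_mat_def toeplitz_def fps_rows_def)

lemma fps_at_mat_jordan_block: "fps_at_mat n g (jordan_block n 0) = toeplitz n g"
  by (simp add: jordan_block_eq_toeplitz fps_at_mat_toeplitz)

lemma comp_inv_at_jordan_block:
  assumes "fps_nth f 0 = c"
  shows "comp_inv_at_mat n f (jordan_block n c) = toeplitz n (comp_inv n f)"
proof -
  have "jordan_block n c - c \<cdot>\<^sub>m 1\<^sub>m n = jordan_block n 0"
    by (rule eq_matI) auto
  then show ?thesis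
    by (simp add: comp_inv_at_mat_def assms fps_at_mat_jordan_block)
qed

section \<open>Change of variable by a substitution matrix\<close>

text \<open>Row i of both products is F^i * (u o F): on the left it arises as (x^i * u) o F, on the
  right by multiplying F^i.\<close>

lemma toeplitz_mult_powers:
  assumes "fps_nth F 0 = 0"
  shows "toeplitz n u * fps_rows n (\<lambda>i. F ^ i) = fps_rows n (\<lambda>i. F ^ i) * toeplitz n (u oo F)"
  by (simp add: toeplitz_def[of n u] fps_rows_mult_powers fps_rows_mult_toeplitz assms
      fps_compose_mult_distrib flip: fps_compose_power)

text \<open>F^i starts in degree i with coefficient F'(0)^i, so the matrix is upper triangular and
  its determinant is the product of these coefficients.\<close>

lemma fps_rows_powers_inverse:
  assumes "fps_nth F 0 = 0" and "n \<ge> 2 \<Longrightarrow> fps_nth F 1 \<noteq> 0"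
  obtains S where "S \<in> carrier_mat n n"
    "fps_rows n (\<lambda>i. F ^ i) * S = 1\<^sub>m n" "S * fps_rows n (\<lambda>i. F ^ i) = 1\<^sub>m n"
proof -
  let ?R = "fps_rows n (\<lambda>i. F ^ i)"
  have "upper_triangular ?R"
    using startsby_zero_power_prefix[OF assms(1)]
    by (auto simp: upper_triangular_def fps_rows_def)
  then have "det ?R = prod_list (diag_mat ?R)"
    by (rule det_upper_triangular) (rule fps_rows_carrier)
  also have "\<dots> = (\<Prod>i = 0..<n. fps_nth F 1 ^ i)"
    unfolding prod_list_diag_prod
    by (rule prod.cong) (auto simp: fps_rows_def startsby_zero_power_nth_same assms(1))
  \<comment> \<open>For \<open>n < 2\<close> at most the exponent 0 occurs and the product is 1,
    whatever F'(0) is.\<close>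
  also have "\<dots> \<noteq> 0"
    using assms(2) by (cases "n \<ge> 2") (auto simp: not_le less_2_cases_iff)
  finally have "?R \<in> Units (ring_mat TYPE(complex) n ())"
    by (intro det_non_zero_imp_unit fps_rows_carrier)
  then show ?thesis
    using that by (auto simp: Units_def ring_mat_def)
qed

section \<open>The equivalence on a single Jordan block\<close>

text \<open>The inverses are part of the conclusion so that the block sums of \<open>P\<close> and
  \<open>Q\<close> can later be inverted block by block.\<close>

lemma jordan_block_equivalence:
  fixes A :: "complex fps" and z lam :: complex and n :: nat
  defines "D \<equiv> 1 + fps_const z * A"
  defines "f \<equiv> (fps_const lam + fps_X) / D" and "g \<equiv> A / D"
  defines "\<mu> \<equiv> lam / (1 + z * fps_nth A 0)"
  assumes D0: "1 + z * fps_nth A 0 \<noteq> 0"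
    and D1: "n \<ge> 2 \<Longrightarrow> 1 + z * (fps_nth A 0 - fps_nth A 1 * lam) \<noteq> 0"
  shows "\<exists>P P' Q Q'. P \<in> carrier_mat n n \<and> P' \<in> carrier_mat n n \<and>
    Q \<in> carrier_mat n n \<and> Q' \<in> carrier_mat n n \<and>
    P * P' = 1\<^sub>m n \<and> P' * P = 1\<^sub>m n \<and> Q * Q' = 1\<^sub>m n \<and> Q' * Q = 1\<^sub>m n \<and>
    P * (1\<^sub>m n + z \<cdot>\<^sub>m toeplitz n A) * Q = 1\<^sub>m n \<and>
    P * jordan_block n lam * Q = jordan_block n \<mu> \<and>
    P * toeplitz n A * Q = fps_at_mat n g (comp_inv_at_mat n f (jordan_block n \<mu>))"
proof -
  have D0': "fps_nth D 0 = 1 + z * fps_nth A 0" by (simp add: D_def)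
  with D0 have Dnz: "fps_nth D 0 \<noteq> 0" by simp
  have f_eq: "f = (fps_const lam + fps_X) * inverse D" and g_eq: "g = A * inverse D"
    using Dnz by (simp_all add: f_def g_def fps_divide_unit)
  have D_inv: "D * inverse D = 1" using Dnz by (rule inverse_mult_eq_1')
  have fD: "f * D = fps_const lam + fps_X"
    by (simp add: f_eq mult.assoc D_inv mult.commute[of "inverse D"])
  have f0: "fps_nth f 0 = \<mu>"
    using Dnz by (simp add: f_eq \<mu>_def D0' divide_inverse)
  \<comment> \<open>The linear coefficient of f * D = lam + x is f'(0) D(0) + \<mu> D'(0) = 1. If
    f'(0) were 0, then lam * D'(0) = D(0), which is exactly what \<open>D1\<close> excludes.\<close>
  have f1: "fps_nth f 1 \<noteq> 0" if "n \<ge> 2"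
  proof
    assume 0: "fps_nth f 1 = 0"
    have "fps_nth (f * D) 1 = 1" by (simp add: fD)
    then have "\<mu> * (z * fps_nth A 1) = 1"
      using 0 by (simp add: fps_mult_nth f0 D_def)
    then have "lam * (z * fps_nth A 1) = 1 + z * fps_nth A 0"
      using D0 by (simp add: \<mu>_def field_simps)
    then show False using D1[OF that] by (simp add: algebra_simps)
  qed
  define F where "F = f - fps_const \<mu>"
  have F0: "fps_nth F 0 = 0" by (simp add: F_def f0)
  have F1: "n \<ge> 2 \<Longrightarrow> fps_nth F 1 \<noteq> 0" using f1 by (simp add: F_def)
  define P where "P = fps_rows n (\<lambda>i. F ^ i)"
  obtain P' where P': "P' \<in> carrier_mat n n" and PP': "P * P' = 1\<^sub>m n" and P'P: "P' * P = 1\<^sub>m n"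
    using fps_rows_powers_inverse[OF F0 F1] unfolding P_def by blast
  have P: "P \<in> carrier_mat n n" by (simp add: P_def)
  define Q where "Q = toeplitz n (inverse D) * P'"
  define Q' where "Q' = P * toeplitz n D"
  have Q: "Q \<in> carrier_mat n n" and Q': "Q' \<in> carrier_mat n n"
    using P P' toeplitz_carrier by (auto simp: Q_def Q'_def intro!: mult_carrier_mat)
  have QQ': "Q' * Q = 1\<^sub>m n"
  proof -
    have "Q' * Q = P * (toeplitz n D * (toeplitz n (inverse D) * P'))"
      unfolding Q_def Q'_def using P P' by (intro assoc_mult_mat) auto
    also have "toeplitz n D * (toeplitz n (inverse D) * P') = P'"
      using P' by (subst assoc_mult_mat[symmetric]) (auto simp: toeplitz_mult D_inv toeplitz_one)
    finally show ?thesis using PP' by simp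
  qed
  \<comment> \<open>Since P * (v o F) = v * P as matrices, the equation reduces to u / D = v o F.
    The condition compares Toeplitz matrices, so agreement modulo x^n suffices.\<close>
  have conj: "P * toeplitz n u * Q = toeplitz n v"
    if "toeplitz n (u * inverse D) = toeplitz n (v oo F)" for u v
  proof -
    have "P * toeplitz n u * Q = P * (toeplitz n u * (toeplitz n (inverse D) * P'))"
      unfolding Q_def using P P' by (intro assoc_mult_mat) auto
    also have "toeplitz n u * (toeplitz n (inverse D) * P') = toeplitz n (v oo F) * P'"
      using P' that by (subst assoc_mult_mat[symmetric]) (auto simp: toeplitz_mult)
    also have "P * (toeplitz n (v oo F) * P') = toeplitz n v * P * P'"
      using P P' F0 by (subst assoc_mult_mat[symmetric]) (auto simp: toeplitz_mult_powers P_def)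
    also have "\<dots> = toeplitz n v * (P * P')"
      using P P' by (intro assoc_mult_mat) auto
    finally show ?thesis by (simp add: PP' right_mult_one_mat[OF toeplitz_carrier])
  qed
  have "1\<^sub>m n + z \<cdot>\<^sub>m toeplitz n A = toeplitz n D"
    by (simp add: D_def toeplitz_add toeplitz_const_mult toeplitz_one)
  moreover have "P * toeplitz n D * Q = toeplitz n 1"
    by (rule conj) (simp add: D_inv)
  moreover have "P * jordan_block n lam * Q = jordan_block n \<mu>"
    unfolding jordan_block_eq_toeplitz
  proof (rule conj)
    \<comment> \<open>Here the condition holds exactly as power series: \<mu> + F = f = (lam + x) /
      D.\<close>
    have "(fps_const \<mu> + fps_X) oo F = fps_const \<mu> + F"
      by (simp add: fps_compose_add_distrib F0)
    then show "toeplitz n ((fps_const lam + fps_X) * inverse D) = toeplitz n ((fps_const \<mu> + fps_X) oo F)"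
      by (simp add: F_def flip: f_eq)
  qed
  moreover have "P * toeplitz n A * Q = toeplitz n (g oo comp_inv n f)"
  proof (rule conj)
    have h0: "fps_nth (comp_inv n f oo F) 0 = 0" by (simp add: comp_inv_nth_0)
    \<comment> \<open>The composite \<open>comp_inv n f oo F\<close> is x only modulo x^n. Pulling
      \<open>g\<close> out as \<open>fps_at_mat\<close> leaves an expression depending only on the
      Toeplitz matrix of the inner series, where the congruence can be substituted.\<close>
    have "toeplitz n (g oo comp_inv n f oo F) = fps_at_mat n g (toeplitz n (comp_inv n f oo F))"
      using F0 by (simp add: fps_at_mat_toeplitz h0 fps_compose_assoc comp_inv_nth_0)
    also have "toeplitz n (comp_inv n f oo F) = toeplitz n fps_X"
      unfolding F_def f0[symmetric] by (intro toeplitz_cong comp_inv_compose f1)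
    finally show "toeplitz n (A * inverse D) = toeplitz n (g oo comp_inv n f oo F)"
      by (simp add: fps_at_mat_toeplitz g_eq)
  qed
  moreover have "fps_at_mat n g (comp_inv_at_mat n f (jordan_block n \<mu>)) = toeplitz n (g oo comp_inv n f)"
    by (simp add: comp_inv_at_jordan_block f0 fps_at_mat_toeplitz comp_inv_nth_0)
  moreover have "Q * Q' = 1\<^sub>m n"
    using mat_mult_left_right_inverse[OF Q' Q QQ'] .
  ultimately show ?thesis
    using P P' Q Q' PP' P'P QQ' by (intro exI[of _ P] exI[of _ P'] exI[of _ Q] exI[of _ Q']) (simp add: toeplitz_one)
qed

section \<open>Blockwise arithmetic of direct sums\<close>

lemma diag_block_mat_carrier:
  assumes "\<And>i. i \<in> set xs \<Longrightarrow> B i \<in> carrier_mat (d i) (d i)"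
  shows "diag_block_mat (map B xs) \<in> carrier_mat (\<Sum>i\<leftarrow>xs. d i) (\<Sum>i\<leftarrow>xs. d i)"
  using assms by (intro carrier_matI)
    (auto simp: dim_diag_block_mat comp_def carrier_matD[OF assms] cong: map_cong)

lemma diag_block_mat_mult:
  fixes B C :: "'b \<Rightarrow> 'a :: semiring_1 mat"
  assumes "\<And>i. i \<in> set xs \<Longrightarrow> B i \<in> carrier_mat (d i) (d i)"
    and "\<And>i. i \<in> set xs \<Longrightarrow> C i \<in> carrier_mat (d i) (d i)"
  shows "diag_block_mat (map B xs) * diag_block_mat (map C xs) = diag_block_mat (map (\<lambda>i. B i * C i) xs)"
  using assms
proof (induction xs)
  case (Cons x xs)
  let ?s = "\<Sum>i\<leftarrow>xs. d i"
  have B: "diag_block_mat (map B xs) \<in> carrier_mat ?s ?s"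
    and C: "diag_block_mat (map C xs) \<in> carrier_mat ?s ?s"
    and x: "B x \<in> carrier_mat (d x) (d x)" "C x \<in> carrier_mat (d x) (d x)"
    using Cons.prems by (auto intro: diag_block_mat_carrier)
  have "diag_block_mat (map B xs) * diag_block_mat (map C xs) = diag_block_mat (map (\<lambda>i. B i * C i) xs)"
    using Cons by simp
  \<comment> \<open>Read from right to left, the hypothesis makes the tail of the target a product
    of the two matrices whose dimensions are recorded in \<open>B\<close> and
    \<open>C\<close>.\<close>
  note IH = this[symmetric]
  show ?case
    using B C x
    by (auto simp: Let_def IH carrier_matD mult_four_block_mat[OF x(1) _ _ B x(2) _ _ C])
qed simp

lemma diag_block_mat_one:
  "diag_block_mat (map (\<lambda>i. 1\<^sub>m (d i)) xs) = 1\<^sub>m (\<Sum>i\<leftarrow>xs. d i)"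
  by (induction xs) (auto simp: Let_def)

text \<open>Brings E + z A into block form, so that the single-block equation for 1 + z A applies to
  each summand.\<close>

lemma diag_block_mat_one_add_smult:
  fixes B :: "'b \<Rightarrow> 'a :: semiring_1 mat"
  assumes "\<And>i. i \<in> set xs \<Longrightarrow> B i \<in> carrier_mat (d i) (d i)"
  shows "1\<^sub>m (\<Sum>i\<leftarrow>xs. d i) + c \<cdot>\<^sub>m diag_block_mat (map B xs) =
    diag_block_mat (map (\<lambda>i. 1\<^sub>m (d i) + c \<cdot>\<^sub>m B i) xs)"
  using assms
proof (induction xs)
  case (Cons x xs)
  let ?s = "\<Sum>i\<leftarrow>xs. d i"
  have B: "diag_block_mat (map B xs) \<in> carrier_mat ?s ?s"
    and x: "B x \<in> carrier_mat (d x) (d x)"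
    using Cons.prems by (auto intro: diag_block_mat_carrier)
  have "1\<^sub>m ?s + c \<cdot>\<^sub>m diag_block_mat (map B xs) = diag_block_mat (map (\<lambda>i. 1\<^sub>m (d i) + c \<cdot>\<^sub>m B i) xs)"
    using Cons by simp
  note IH = this[symmetric]
  show ?case
    using B x by (intro eq_matI) (auto simp: Let_def IH carrier_matD)
qed auto

lemma diag_block_mat_eqI:
  "(\<And>i. i \<in> set xs \<Longrightarrow> B i = C i) \<Longrightarrow> diag_block_mat (map B xs) = diag_block_mat (map C xs)"
  by (simp cong: map_cong)

section \<open>Invertibility and SLOCC equivalence\<close>

lemma invertible_matI:
  "P \<in> carrier_mat n n \<Longrightarrow> P' \<in> carrier_mat n n \<Longrightarrow> P * P' = 1\<^sub>m n \<Longrightarrow> P' * P = 1\<^sub>m n \<Longrightarrow> invertible_mat P"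
  unfolding invertible_mat_def inverts_mat_def by (auto simp: square_mat.simps)

text \<open>By linearity P (E + z A) Q = P E Q + z P A Q. Adding z times the third matrix to the
  first is thus the work of \<open>T\<close>, an elementary matrix with first row (1, 0, z) and the
  other two rows those of the identity.\<close>

lemma slocc_equivI:
  assumes M: "E \<in> carrier_mat N N" "J \<in> carrier_mat N N" "A \<in> carrier_mat N N"
      "E' \<in> carrier_mat N N" "J' \<in> carrier_mat N N" "A' \<in> carrier_mat N N"
    and P: "P \<in> carrier_mat N N" "invertible_mat P" and Q: "Q \<in> carrier_mat N N" "invertible_mat Q"
    and E': "P * (E + z \<cdot>\<^sub>m A) * Q = E'" and J': "P * J * Q = J'" and A': "P * A * Q = A'"
  shows "slocc_equiv N [E, J, A] [E', J', A']"
proof -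
  define U where "U z = (mat 3 3 (\<lambda>(i, j). if i = j then 1 else if i = 0 \<and> j = 2 then z else 0) :: complex mat)" for z
  have U: "U z \<in> carrier_mat 3 3" for z by (simp add: U_def)
  \<comment> \<open>These shears form a one-parameter group, so \<open>U (- z)\<close> inverts
    \<open>U z\<close>.\<close>
  have mult: "U z * U w = U (z + w)" for z w
    by (rule eq_matI) (auto simp: U_def scalar_prod_def eval_nat_numeral less_Suc_eq)
  have "U 0 = 1\<^sub>m 3" by (rule eq_matI) (auto simp: U_def)
  then have "invertible_mat (U z)"
    by (intro invertible_matI[OF U U[of "- z"]]) (simp_all add: mult)
  moreover have carr: "P * X * Q \<in> carrier_mat N N" for X
    using P(1) Q(1) by auto
  have "P * (E + z \<cdot>\<^sub>m A) * Q = P * E * Q + z \<cdot>\<^sub>m (P * A * Q)"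
  proof -
    have "P * (E + z \<cdot>\<^sub>m A) = P * E + z \<cdot>\<^sub>m (P * A)"
      using P M by (simp add: mult_add_distrib_mat[of _ N N _ N] mult_smult_distrib[of _ N N _ N])
    also have "\<dots> * Q = P * E * Q + z \<cdot>\<^sub>m (P * A) * Q"
      using P M Q by (intro add_mult_distrib_mat) auto
    also have "z \<cdot>\<^sub>m (P * A) * Q = z \<cdot>\<^sub>m (P * A * Q)"
      using P M Q by (intro mult_smult_assoc_mat) auto
    finally show ?thesis .
  qed
  with E' A' have "P * E * Q + z \<cdot>\<^sub>m A' = E'" by simp
  then have "\<forall>i<3. U z $$ (i, 0) \<cdot>\<^sub>m (P * ([E, J, A] ! 0) * Q) + U z $$ (i, 1) \<cdot>\<^sub>m (P * ([E, J, A] ! 1) * Q)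
      + U z $$ (i, 2) \<cdot>\<^sub>m (P * ([E, J, A] ! 2) * Q) = [E', J', A'] ! i"
    using M J' A' carr[of E]
    by (auto simp: U_def eval_nat_numeral less_Suc_eq intro!: eq_matI)
  ultimately show ?thesis
    unfolding slocc_equiv_def using M P Q U[of z]
    by (intro conjI exI[of _ "U z"] exI[of _ P] exI[of _ Q]) auto
qed

section \<open>Assembling the blocks\<close>

theorem mainTheorem2:
  fixes k :: nat
    and n :: "nat \<Rightarrow> nat"
    and lam :: "nat \<Rightarrow> complex"
    and a :: "nat \<Rightarrow> nat \<Rightarrow> complex"
    and z2 :: complex
  defines "N \<equiv> \<Sum>i<k. n i"
    and "fA \<equiv> \<lambda>i. \<Sum>m<n i. fps_const (a i m) * fps_X ^ m"
  defines "E \<equiv> (1\<^sub>m N :: complex mat)"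
    and "J \<equiv> diag_block_mat (map (\<lambda>i. jordan_block (n i) (lam i)) [0..<k])"
    and "A \<equiv> diag_block_mat (map (\<lambda>i. fps_at_mat (n i) (fA i) (jordan_block (n i) 0)) [0..<k])"
    and "f \<equiv> \<lambda>i. (fps_const (lam i) + fps_X) / (1 + fps_const z2 * fA i)"
    and "g \<equiv> \<lambda>i. fA i / (1 + fps_const z2 * fA i)"
    and "\<mu> \<equiv> \<lambda>i. lam i / (1 + z2 * a i 0)"
  defines "J' \<equiv> diag_block_mat (map (\<lambda>i. jordan_block (n i) (\<mu> i)) [0..<k])"
    and "A'' \<equiv> diag_block_mat (map (\<lambda>i. fps_at_mat (n i) (g i)
            (comp_inv_at_mat (n i) (f i) (jordan_block (n i) (\<mu> i)))) [0..<k])"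
  assumes "\<And>i. i < k \<Longrightarrow> n i \<ge> 1"
    and "\<And>i. i < k \<Longrightarrow> 1 + z2 * a i 0 \<noteq> 0"
    and "\<And>i. i < k \<Longrightarrow> n i \<ge> 2 \<Longrightarrow> 1 + z2 * (a i 0 - a i 1 * lam i) \<noteq> 0"
  shows "(\<exists>P Q. P \<in> carrier_mat N N \<and> invertible_mat P \<and>
            Q \<in> carrier_mat N N \<and> invertible_mat Q \<and>
            P * (E + z2 \<cdot>\<^sub>m A) * Q = E \<and> P * J * Q = J' \<and> P * A * Q = A'') \<and>
         slocc_equiv N [E, J, A] [E, J', A'']"
proof -
  let ?s = "[0..<k]"
  have N: "(\<Sum>i\<leftarrow>?s. n i) = N"
    by (simp add: N_def interv_sum_list_conv_sum_set_nat atLeast0LessThan)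
  have fA_nth: "fps_nth (fA i) m = (if m < n i then a i m else 0)" for i m
    by (simp add: fA_def fps_sum_nth if_distrib cong: if_cong)
  have A_eq: "A = diag_block_mat (map (\<lambda>i. toeplitz (n i) (fA i)) ?s)"
    by (simp add: A_def fps_at_mat_jordan_block)
  define B where "B i = fps_at_mat (n i) (g i) (comp_inv_at_mat (n i) (f i) (jordan_block (n i) (\<mu> i)))" for i
  have "\<exists>P P' Q Q'. P \<in> carrier_mat (n i) (n i) \<and> P' \<in> carrier_mat (n i) (n i) \<and>
      Q \<in> carrier_mat (n i) (n i) \<and> Q' \<in> carrier_mat (n i) (n i) \<and>
      P * P' = 1\<^sub>m (n i) \<and> P' * P = 1\<^sub>m (n i) \<and> Q * Q' = 1\<^sub>m (n i) \<and> Q' * Q = 1\<^sub>m (n i) \<and>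
      P * (1\<^sub>m (n i) + z2 \<cdot>\<^sub>m toeplitz (n i) (fA i)) * Q = 1\<^sub>m (n i) \<and>
      P * jordan_block (n i) (lam i) * Q = jordan_block (n i) (\<mu> i) \<and>
      P * toeplitz (n i) (fA i) * Q = B i" (is "\<exists>P P' Q Q'. ?block i P P' Q Q'") if "i < k" for i
  proof -
    \<comment> \<open>The polynomial \<open>fA i\<close> stops below degree \<open>n i\<close>:
      \<open>n i \<ge> 1\<close> makes \<open>a i 0\<close> its constant coefficient, but
      \<open>a i 1\<close> is its linear coefficient only once \<open>n i \<ge> 2\<close>.\<close>
    have 0: "fps_nth (fA i) 0 = a i 0" and 1: "n i \<ge> 2 \<Longrightarrow> fps_nth (fA i) 1 = a i 1"
      using assms(11)[OF that] by (simp_all add: fA_nth)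
    show ?thesis
      using jordan_block_equivalence[of z2 "fA i" "n i" "lam i"] assms(12,13)[OF that] 0 1
      by (simp add: B_def f_def g_def \<mu>_def)
  qed
  \<comment> \<open>With the bound on \<open>i\<close> moved inside the existential quantifiers,
    \<open>choice_iff\<close> yields the four witnesses as total functions of
    \<open>i\<close>.\<close>
  then have "\<forall>i. \<exists>P P' Q Q'. i < k \<longrightarrow> ?block i P P' Q Q'"
    by blast
  then obtain P P' Q Q' where "\<forall>i. i < k \<longrightarrow> ?block i (P i) (P' i) (Q i) (Q' i)"
    unfolding choice_iff by blast
  then have carr:
      "\<And>i. i < k \<Longrightarrow> P i \<in> carrier_mat (n i) (n i)" "\<And>i. i < k \<Longrightarrow> P' i \<in> carrier_mat (n i) (n i)"
      "\<And>i. i < k \<Longrightarrow> Q i \<in> carrier_mat (n i) (n i)" "\<And>i. i < k \<Longrightarrow> Q' i \<in> carrier_mat (n i) (n i)"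
    and inv: "\<And>i. i < k \<Longrightarrow> P i * P' i = 1\<^sub>m (n i)" "\<And>i. i < k \<Longrightarrow> P' i * P i = 1\<^sub>m (n i)"
      "\<And>i. i < k \<Longrightarrow> Q i * Q' i = 1\<^sub>m (n i)" "\<And>i. i < k \<Longrightarrow> Q' i * Q i = 1\<^sub>m (n i)"
    and eqs: "\<And>i. i < k \<Longrightarrow> P i * (1\<^sub>m (n i) + z2 \<cdot>\<^sub>m toeplitz (n i) (fA i)) * Q i = 1\<^sub>m (n i)"
      "\<And>i. i < k \<Longrightarrow> P i * jordan_block (n i) (lam i) * Q i = jordan_block (n i) (\<mu> i)"
      "\<And>i. i < k \<Longrightarrow> P i * toeplitz (n i) (fA i) * Q i = B i"
    by blast+
  let ?diag = "\<lambda>M. diag_block_mat (map M ?s)"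
  have diag_carr: "?diag M \<in> carrier_mat N N"
    if "\<And>i. i < k \<Longrightarrow> M i \<in> carrier_mat (n i) (n i)" for M :: "nat \<Rightarrow> complex mat"
    using diag_block_mat_carrier[of ?s M n] that by (simp add: N)
  have diag_inv: "?diag M * ?diag M' = 1\<^sub>m N"
    if "\<And>i. i < k \<Longrightarrow> M i \<in> carrier_mat (n i) (n i)" "\<And>i. i < k \<Longrightarrow> M' i \<in> carrier_mat (n i) (n i)"
      "\<And>i. i < k \<Longrightarrow> M i * M' i = 1\<^sub>m (n i)" for M M' :: "nat \<Rightarrow> complex mat"
  proof -
    have "?diag M * ?diag M' = ?diag (\<lambda>i. M i * M' i)"
      using that by (intro diag_block_mat_mult) auto
    also have "\<dots> = ?diag (\<lambda>i. 1\<^sub>m (n i))"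
      using that by (intro diag_block_mat_eqI) auto
    finally show ?thesis by (simp add: diag_block_mat_one N)
  qed
  \<comment> \<open>Lifts all three block equations to the direct sum: \<open>M\<close> is in turn 1
    + z2 A, the Jordan block and A on each block.\<close>
  have diag_eq: "?diag P * ?diag M * ?diag Q = ?diag M'"
    if "\<And>i. i < k \<Longrightarrow> M i \<in> carrier_mat (n i) (n i)" "\<And>i. i < k \<Longrightarrow> P i * M i * Q i = M' i"
    for M M' :: "nat \<Rightarrow> complex mat"
  proof -
    have "?diag P * ?diag M = ?diag (\<lambda>i. P i * M i)"
      using that carr by (intro diag_block_mat_mult) auto
    also have "\<dots> * ?diag Q = ?diag (\<lambda>i. P i * M i * Q i)"
      using mult_carrier_mat[OF carr(1) that(1)] carr(3) by (intro diag_block_mat_mult) auto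
    also have "\<dots> = ?diag M'"
      using that by (intro diag_block_mat_eqI) auto
    finally show ?thesis .
  qed
  have P: "?diag P \<in> carrier_mat N N" and Q: "?diag Q \<in> carrier_mat N N"
    using carr by (simp_all add: diag_carr)
  have iP: "invertible_mat (?diag P)"
    by (rule invertible_matI[OF P diag_carr[OF carr(2)]
          diag_inv[OF carr(1) carr(2) inv(1)] diag_inv[OF carr(2) carr(1) inv(2)]])
  have iQ: "invertible_mat (?diag Q)"
    by (rule invertible_matI[OF Q diag_carr[OF carr(4)]
          diag_inv[OF carr(3) carr(4) inv(3)] diag_inv[OF carr(4) carr(3) inv(4)]])
  have "E + z2 \<cdot>\<^sub>m A = ?diag (\<lambda>i. 1\<^sub>m (n i) + z2 \<cdot>\<^sub>m toeplitz (n i) (fA i))"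
    using diag_block_mat_one_add_smult[of ?s "\<lambda>i. toeplitz (n i) (fA i)" n z2]
    by (simp add: N E_def A_eq)
  also have "?diag P * \<dots> * ?diag Q = ?diag (\<lambda>i. 1\<^sub>m (n i))"
    using eqs by (intro diag_eq) auto
  finally have 1: "?diag P * (E + z2 \<cdot>\<^sub>m A) * ?diag Q = E"
    by (simp add: diag_block_mat_one N E_def)
  have 2: "?diag P * J * ?diag Q = J'"
    unfolding J_def J'_def using eqs by (intro diag_eq) auto
  have 3: "?diag P * A * ?diag Q = A''"
    unfolding A_eq A''_def using eqs by (intro diag_eq) (auto simp: B_def)
  have "E \<in> carrier_mat N N" "J \<in> carrier_mat N N" "A \<in> carrier_mat N N"
    "J' \<in> carrier_mat N N" "A'' \<in> carrier_mat N N"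
    by (auto simp: E_def J_def J'_def A_eq A''_def fps_at_mat_def intro!: diag_carr)
  then have "slocc_equiv N [E, J, A] [E, J', A'']"
    using P Q iP iQ 1 2 3 by (intro slocc_equivI)
  with P Q iP iQ 1 2 3 show ?thesis by blast
qed

end
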